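(* There exists a constant $C>0$, depending (increasingly) only on $\max_i|\rho^i|$ (the function $b$ being fixed; in particular $C$ does not depend on $N$ or $K$), such that for all $K>0$ sufficiently small we have, for $X\sim\pi$, $$\mathbb{E}\left[\frac1N|X-\rho|_1\right]\le C\sqrt{K},$$ where $\pi$ is the stationary distribution of the Elo process with parameters $\rho$, $b$, $(\mathcal{L}(S^{ij}))_{i\ne j}$ and $K$.
   Context: Notation: $\mathbb{N}=\{0,1,2,\dots\}$; $N\ge 2$ is an integer (number of players); $|\cdot|_1$ is the 1-norm on $\mathbb{R}^N$; $x^i$ is the $i$-th coordinate of $x$; $e_i$ is the $i$-th canonical vector; $\mathcal{Z}_N=\{x\in\mathbb{R}^N:\sum_{i=1}^N x^i=0\}$; $\mathcal{L}(\cdot)$ denotes the law of a random element. Standing assumptions. (i) $\rho=(\rho^1,\dots,\rho^N)\in\mathcal{Z}_N$ is a fixed vector (true skills). (ii) $b:\mathbb{R}\to(-1,1)$ is odd, strictly increasing and $L$-Lipschitz, and for every $M>0$, $\ell_M:=\inf_{-M\le v<u\le M}\frac{b(u)-b(v)}{u-v}>0$. (iii) For every distinct $i,j\in\{1,\dots,N\}$, $S^{ij}$ is a random variable with values in $[-1,1]$, $\mathbb{E}[S^{ij}]=b(\rho^i-\rho^j)$ and $S^{ji}=-S^{ij}$. (iv) $K>0$ is a constant with $KL<1$. (v) For every distinct $i,j$ and every $\epsilon>0$, $\mathbb{P}(S^{ij}<-1+\epsilon)>0$ and $\mathbb{P}(S^{ij}>1-\epsilon)>0$. Elo process: the Markov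 chain $(X_t)_{t\in\mathbb{N}}$ on $\mathcal{Z}_N$ started from a random vector $X_0\in\mathcal{Z}_N$ with the following dynamics: at step $t$, an ordered pair $(I_t,J_t)$ of distinct indices in $\{1,\dots,N\}$ is chosen uniformly at random (independently of the past); given $I_t=i,J_t=j$, an independent copy $S_t^{ij}$ of $S^{ij}$ is sampled; and $X_{t+1}=X_t+K\{S_t^{ij}-b(X_t^i-X_t^j)\}(e_i-e_j)$. It has a unique stationary distribution on $\mathcal{Z}_N$, denoted $\pi$. *)

theory Defs
  imports "HOL-Probability.Probability"
begin

definition secant_slope_inf :: "(real \<Rightarrow> real) \<Rightarrow> real \<Rightarrow> real" where
  "secant_slope_inf b M =
     (INF (u, v) \<in> {(u, v). -M \<le> v \<and> v < u \<and> u \<le> M}. (b u - b v) / (u - v))"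

text \<open>
  The number of players is quantified inside the theorem, so vectors of length N are
  functions on \<open>{1..N}\<close> that are \<open>undefined\<close> elsewhere, which are the points of the
  library's finite product measure spaces.
\<close>

definition zero_sum :: "nat \<Rightarrow> (nat \<Rightarrow> real) set" where
  "zero_sum N = {x \<in> {1..N} \<rightarrow>\<^sub>E UNIV. (\<Sum>i\<in>{1..N}. x i) = 0}"

definition elo_space :: "nat \<Rightarrow> (nat \<Rightarrow> real) measure" where
  "elo_space N = restrict_space (PiM {1..N} (\<lambda>_. borel)) (zero_sum N)"

definition players_pairs :: "nat \<Rightarrow> (nat \<times> nat) set" where
  "players_pairs N = {(i, j). i \<in> {1..N} \<and> j \<in> {1..N} \<and> i \<noteq> j}"

text \<open>
  The dynamics depend on the scores only through their individual laws:
  \<open>\<nu> i j\<close> is the law of the score of player \<open>i\<close> against player \<open>j\<close>, and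
  the relation \<open>S\<^sup>j\<^sup>i = - S\<^sup>i\<^sup>j\<close> becomes a statement on image measures.
  Nothing is required of \<open>\<nu> i j\<close> outside \<open>players_pairs N\<close>.
\<close>

definition score_laws ::
  "nat \<Rightarrow> (real \<Rightarrow> real) \<Rightarrow> (nat \<Rightarrow> real) \<Rightarrow> (nat \<Rightarrow> nat \<Rightarrow> real measure) \<Rightarrow> bool" where
  "score_laws N b \<rho> \<nu> \<longleftrightarrow>
     (\<forall>(i, j) \<in> players_pairs N.
        real_distribution (\<nu> i j) \<and>
        (AE s in \<nu> i j. s \<in> {-1..1}) \<and>
        (\<integral>s. s \<partial>\<nu> i j) = b (\<rho> i - \<rho> j) \<and>
        \<nu> j i = distr (\<nu> i j) borel uminus \<and>
        (\<forall>\<epsilon>>0. measure (\<nu> i j) {..< -1 + \<epsilon>} > 0 \<and> measure (\<nu> i j) {1 - \<epsilon> <..} > 0))"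

definition elo_update ::
  "nat \<Rightarrow> (real \<Rightarrow> real) \<Rightarrow> real \<Rightarrow> (nat \<Rightarrow> real) \<Rightarrow> nat \<Rightarrow> nat \<Rightarrow> real \<Rightarrow> nat \<Rightarrow> real" where
  "elo_update N b K x i j s =
     (\<lambda>k\<in>{1..N}. x k + K * (s - b (x i - x j)) * (of_bool (k = i) - of_bool (k = j)))"

definition elo_kernel ::
  "nat \<Rightarrow> (real \<Rightarrow> real) \<Rightarrow> (nat \<Rightarrow> nat \<Rightarrow> real measure) \<Rightarrow> real
     \<Rightarrow> (nat \<Rightarrow> real) \<Rightarrow> (nat \<Rightarrow> real) measure" where
  "elo_kernel N b \<nu> K x =
     uniform_count_measure (players_pairs N) \<bind>
       (\<lambda>(i, j). distr (\<nu> i j) (elo_space N) (elo_update N b K x i j))"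

definition stationary_distribution :: "'a measure \<Rightarrow> ('a \<Rightarrow> 'a measure) \<Rightarrow> 'a measure \<Rightarrow> bool" where
  "stationary_distribution S \<kappa> \<pi> \<longleftrightarrow> prob_space \<pi> \<and> sets \<pi> = sets S \<and> \<pi> \<bind> \<kappa> = \<pi>"

text \<open>
  The Giry bind is only meaningful for measurable kernels; the next lemmas show that
  this is the case here.
\<close>

lemma space_elo_space: "space (elo_space N) = zero_sum N"
  by (auto simp: elo_space_def space_restrict_space space_PiM zero_sum_def)

lemma elo_update_zero_sum:
  assumes x: "x \<in> zero_sum N" and ij: "(i, j) \<in> players_pairs N"
  shows "elo_update N b K x i j s \<in> zero_sum N"
proof -
  let ?c = "K * (s - b (x i - x j))"
  have "(\<Sum>k\<in>{1..N}. ?c * (of_bool (k = i) - of_bool (k = j))) =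
      ?c * ((\<Sum>k\<in>{1..N}. of_bool (k = i)) - (\<Sum>k\<in>{1..N}. of_bool (k = j)))"
    by (simp only: sum_distrib_left[symmetric] sum_subtractf)
  also have "\<dots> = 0"
    using ij by (simp add: players_pairs_def of_bool_def)
  finally show ?thesis
    using x by (simp add: zero_sum_def elo_update_def sum.distrib)
qed

lemma elo_update_measurable:
  assumes b: "b \<in> borel_measurable borel" and ij: "(i, j) \<in> players_pairs N"
  shows "(\<lambda>(x, s). elo_update N b K x i j s) \<in> elo_space N \<Otimes>\<^sub>M borel \<rightarrow>\<^sub>M elo_space N"
proof -
  have comp: "(\<lambda>p. fst p k) \<in> borel_measurable (elo_space N \<Otimes>\<^sub>M borel)"
    if "k \<in> {1..N}" for k
    using that unfolding elo_space_def
    by (intro measurable_compose[OF measurable_fst] measurable_restrict_space1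
        measurable_component_singleton)
  have "(\<lambda>(x, s). elo_update N b K x i j s)
      \<in> elo_space N \<Otimes>\<^sub>M borel \<rightarrow>\<^sub>M PiM {1..N} (\<lambda>_. borel)"
    unfolding elo_update_def case_prod_beta
    using ij b
    by (intro measurable_restrict borel_measurable_add borel_measurable_times
        borel_measurable_diff borel_measurable_const comp measurable_snd
        measurable_compose[OF _ b]) (auto simp: players_pairs_def)
  moreover have "(\<lambda>(x, s). elo_update N b K x i j s)
      \<in> space (elo_space N \<Otimes>\<^sub>M borel) \<rightarrow> zero_sum N"
    using elo_update_zero_sum[OF _ ij] by (auto simp: space_pair_measure space_elo_space)
  ultimately show ?thesis
    by (subst (2) elo_space_def) (rule measurable_restrict_space2)
qed

lemma elo_kernel_measurable:
  assumes N: "N \<ge> 2" and b: "b \<in> borel_measurable borel" and \<nu>: "score_laws N b \<rho> \<nu>"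
  shows "elo_kernel N b \<nu> K \<in> elo_space N \<rightarrow>\<^sub>M prob_algebra (elo_space N)"
proof -
  let ?P = "uniform_count_measure (players_pairs N)"
  have fin: "finite (players_pairs N)"
    by (rule finite_subset[of _ "{1..N} \<times> {1..N}"]) (auto simp: players_pairs_def)
  have "(1, 2) \<in> players_pairs N"
    using N by (auto simp: players_pairs_def)
  with fin have "prob_space ?P"
    by (intro prob_space_uniform_count_measure) auto
  then have P: "?P \<in> space (prob_algebra (count_space (players_pairs N)))"
    by (simp add: space_prob_algebra sets_uniform_count_measure)
  have pair: "(\<lambda>x. distr (\<nu> i j) (elo_space N) (elo_update N b K x i j))
      \<in> elo_space N \<rightarrow>\<^sub>M prob_algebra (elo_space N)" if ij: "(i, j) \<in> players_pairs N" for i j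
  proof (rule measurable_distr_prob_space2[where M = borel])
    have "real_distribution (\<nu> i j)"
      using \<nu> ij by (auto simp: score_laws_def)
    then show "(\<lambda>x. \<nu> i j) \<in> elo_space N \<rightarrow>\<^sub>M prob_algebra borel"
      by (intro measurable_const) (simp add: space_prob_algebra real_distribution_def
          real_distribution_axioms_def)
  qed (rule elo_update_measurable[OF b ij])
  have "(\<lambda>(x, p). case p of (i, j) \<Rightarrow> distr (\<nu> i j) (elo_space N) (elo_update N b K x i j))
      \<in> elo_space N \<Otimes>\<^sub>M count_space (players_pairs N) \<rightarrow>\<^sub>M prob_algebra (elo_space N)"
    using fin pair
    by (subst measurable_pair_swap_iff)
      (auto intro!: measurable_pair_measure_countable1 intro: countable_finite simp: case_prod_beta)
  then show ?thesis
    unfolding elo_kernel_def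
    by (intro measurable_bind_prob_space2[where N = "count_space (players_pairs N)"]
        measurable_const P)
qed

end

theory Submission
  imports Defs
begin

text \<open>
  The squared error \<open>V x = (\<Sum>k. (x k - \<rho> k)\<^sup>2)\<close> is a Lyapunov function. A game between \<open>i\<close> and \<open>j\<close>
  moves the two ratings in opposite directions by \<open>K * (s - b (x i - x j))\<close>, and the score \<open>s\<close> has
  mean \<open>b (\<rho> i - \<rho> j)\<close>. So \<open>V\<close> changes on average by at most \<open>- 2 * K * d + 8 * K\<^sup>2\<close>, where the
  dissipation \<open>d = (b (x i - x j) - b (\<rho> i - \<rho> j)) * ((x i - x j) - (\<rho> i - \<rho> j))\<close> is nonnegative
  because \<open>b\<close> is increasing, and the second term comes from the noise, a score and its
  prediction differing by at most \<open>2\<close> (\<open>elo_drift\<close>). Under the stationary law the mean change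
  vanishes, so the dissipation, averaged over pairs, has mean at most \<open>4 * K\<close>
  (\<open>stationary_drift_bound\<close>, \<open>stationary_dissipation_bound\<close>).

  Let \<open>u = (x i - x j) - (\<rho> i - \<rho> j)\<close>. The slope of \<open>b\<close> is at least some \<open>l > 0\<close> within distance
  \<open>1\<close> of \<open>\<rho> i - \<rho> j\<close>, a number of absolute value at most \<open>2 * m\<close>; here \<open>l\<close> depends on
  \<open>m = Max \<bar>\<rho> i\<bar>\<close> only and decreases in it. Then \<open>l * min \<bar>u\<bar> u\<^sup>2 \<le> d\<close>, which for \<open>0 < t \<le> 1\<close>
  gives \<open>\<bar>u\<bar> \<le> t + d / (l * t)\<close> (\<open>abs_le_mono_increment\<close>). As both rating vectors sum to
  zero, the mean of \<open>\<bar>x i - \<rho> i\<bar>\<close> over players is at most the mean of \<open>\<bar>u\<bar>\<close> over pairs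
  (\<open>mean_abs_le_pair_mean\<close>). With \<open>t = sqrt K\<close> the expected error is at most
  \<open>sqrt K + 4 * K / (l * sqrt K) = (1 + 4 / l) * sqrt K\<close> for every \<open>K < 1\<close>.
\<close>


section \<open>Drift at stationarity\<close>

text \<open>
  Integrating the drift inequality against the stationary law would give the claim at once if
  \<open>V\<close> were integrable, which is not known. The truncation \<open>min V n\<close> is integrable and
  satisfies the same inequality on \<open>{V \<le> n}\<close>, while it can only decrease on average
  elsewhere; then \<open>n \<rightarrow> \<infinity>\<close>.
\<close>

lemma stationary_drift_bound:
  fixes V f :: "'a \<Rightarrow> ennreal"
  assumes kernel: "\<kappa> \<in> S \<rightarrow>\<^sub>M prob_algebra S"
    and stat: "stationary_distribution S \<kappa> \<pi>"
    and V [measurable]: "V \<in> borel_measurable S"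
    and f [measurable]: "f \<in> borel_measurable S"
    and V_finite: "\<And>x. x \<in> space S \<Longrightarrow> V x < \<top>"
    and drift: "\<And>x. x \<in> space S \<Longrightarrow> (\<integral>\<^sup>+y. V y \<partial>\<kappa> x) + f x \<le> V x + c"
  shows "(\<integral>\<^sup>+x. f x \<partial>\<pi>) \<le> c"
proof -
  interpret prob_space \<pi>
    using stat by (simp add: stationary_distribution_def)
  have sets_\<pi> [measurable_cong]: "sets \<pi> = sets S" and inv: "\<pi> \<bind> \<kappa> = \<pi>"
    using stat by (auto simp: stationary_distribution_def)
  have space_\<pi>: "space \<pi> = space S"
    using sets_\<pi> by (rule sets_eq_imp_space_eq)
  have \<kappa> [measurable]: "\<kappa> \<in> \<pi> \<rightarrow>\<^sub>M subprob_algebra S"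
    using measurable_prob_algebraD[OF kernel] by (simp cong: measurable_cong_sets add: sets_\<pi>)
  have below: "(\<integral>\<^sup>+x. f x * indicator {x \<in> space S. V x \<le> of_nat n} x \<partial>\<pi>) \<le> c" for n :: nat
  proof -
    let ?V = "\<lambda>x. min (V x) (of_nat n)"
    let ?f = "\<lambda>x. f x * indicator {x \<in> space S. V x \<le> of_nat n} x"
    have step: "(\<integral>\<^sup>+y. ?V y \<partial>\<kappa> x) + ?f x \<le> ?V x + c" if x: "x \<in> space S" for x
    proof (cases "V x \<le> of_nat n")
      case True
      have "(\<integral>\<^sup>+y. ?V y \<partial>\<kappa> x) \<le> (\<integral>\<^sup>+y. V y \<partial>\<kappa> x)"
        by (intro nn_integral_mono) auto
      then show ?thesis
        using True x drift[OF x] by (simp add: min_absorb1) (meson add_right_mono order_trans)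
    next
      case False
      have "prob_space (\<kappa> x)"
        using measurable_space[OF kernel x] by (simp add: space_prob_algebra)
      then have "(\<integral>\<^sup>+y. of_nat n \<partial>\<kappa> x) = of_nat n"
        by (simp add: prob_space.emeasure_space_1)
      moreover have "(\<integral>\<^sup>+y. ?V y \<partial>\<kappa> x) \<le> (\<integral>\<^sup>+y. of_nat n \<partial>\<kappa> x)"
        by (intro nn_integral_mono) auto
      ultimately have "(\<integral>\<^sup>+y. ?V y \<partial>\<kappa> x) \<le> of_nat n"
        by simp
      then show ?thesis
        using False by (simp add: min_absorb2 add_increasing2)
    qed
    have meas: "(\<lambda>x. \<integral>\<^sup>+y. ?V y \<partial>\<kappa> x) \<in> borel_measurable \<pi>"
      by (rule measurable_compose[OF \<kappa> nn_integral_measurable_subprob_algebra]) measurable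
    have "(\<integral>\<^sup>+x. ?V x \<partial>\<pi>) = (\<integral>\<^sup>+x. \<integral>\<^sup>+y. ?V y \<partial>\<kappa> x \<partial>\<pi>)"
      by (subst inv[symmetric], rule nn_integral_bind[OF _ \<kappa>]) measurable
    then have "(\<integral>\<^sup>+x. ?V x \<partial>\<pi>) + (\<integral>\<^sup>+x. ?f x \<partial>\<pi>)
        = (\<integral>\<^sup>+x. (\<integral>\<^sup>+y. ?V y \<partial>\<kappa> x) + ?f x \<partial>\<pi>)"
      using meas by (simp add: nn_integral_add)
    also have "\<dots> \<le> (\<integral>\<^sup>+x. ?V x + c \<partial>\<pi>)"
      using step by (intro nn_integral_mono) (simp add: space_\<pi>)
    also have "\<dots> = (\<integral>\<^sup>+x. ?V x \<partial>\<pi>) + c"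
      by (simp add: nn_integral_add emeasure_space_1)
    finally have le: "(\<integral>\<^sup>+x. ?V x \<partial>\<pi>) + (\<integral>\<^sup>+x. ?f x \<partial>\<pi>) \<le> (\<integral>\<^sup>+x. ?V x \<partial>\<pi>) + c" .
    have "(\<integral>\<^sup>+x. ?V x \<partial>\<pi>) \<le> (\<integral>\<^sup>+x. of_nat n \<partial>\<pi>)"
      by (intro nn_integral_mono) auto
    also have "\<dots> < \<top>"
      by (simp add: emeasure_space_1 of_nat_less_top)
    finally show ?thesis
      using le by (auto simp: ennreal_add_left_cancel_le)
  qed
  have "(\<integral>\<^sup>+x. f x \<partial>\<pi>)
      = (\<integral>\<^sup>+x. (SUP n. f x * indicator {x \<in> space S. V x \<le> of_nat n} x) \<partial>\<pi>)"
  proof (rule nn_integral_cong)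
    fix x assume "x \<in> space \<pi>"
    then have x: "x \<in> space S" by (simp add: space_\<pi>)
    obtain n :: nat where "V x \<le> of_nat n"
      using ennreal_Ex_less_of_nat[of "V x"] V_finite[OF x] by (auto intro: less_imp_le)
    then show "f x = (SUP n. f x * indicator {x \<in> space S. V x \<le> of_nat n} x)"
      using x by (intro antisym SUP_upper2[of n] SUP_least) (auto simp: indicator_def)
  qed
  also have "\<dots> = (SUP n. \<integral>\<^sup>+x. f x * indicator {x \<in> space S. V x \<le> of_nat n} x \<partial>\<pi>)"
  proof (rule nn_integral_monotone_convergence_SUP)
    show "incseq (\<lambda>n x. f x * indicator {x \<in> space S. V x \<le> of_nat n} x)"
      by (intro incseq_SucI le_funI mult_left_mono)
        (auto simp: indicator_def intro: order_trans simp del: of_nat_Suc)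
  qed measurable
  also have "\<dots> \<le> c"
    by (intro SUP_least below)
  finally show ?thesis .
qed

section \<open>Strong monotonicity of the score function\<close>

lemma secant_slope_inf_le:
  assumes "strict_mono b" "- M \<le> v" "v \<le> u" "u \<le> M"
  shows "secant_slope_inf b M * (u - v) \<le> b u - b v"
proof (cases "v = u")
  case False
  have "bdd_below ((\<lambda>(u, v). (b u - b v) / (u - v)) ` {(u, v). -M \<le> v \<and> v < u \<and> u \<le> M})"
    using strict_monoD[OF assms(1)] by (intro bdd_belowI2[of _ 0]) (auto intro!: divide_nonneg_pos less_imp_le)
  from cINF_lower[OF this, of "(u, v)"] have "secant_slope_inf b M \<le> (b u - b v) / (u - v)"
    using assms False by (simp add: secant_slope_inf_def)
  then show ?thesis
    using assms False by (simp add: field_simps)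
qed simp

lemma secant_slope_inf_antimono:
  assumes "strict_mono b" "0 < M" "M \<le> M'"
  shows "secant_slope_inf b M' \<le> secant_slope_inf b M"
  unfolding secant_slope_inf_def
proof (rule cINF_superset_mono)
  show "{(u, v). - M \<le> v \<and> v < u \<and> u \<le> M} \<noteq> {}"
  proof -
    have "(M, 0) \<in> {(u, v). - M \<le> v \<and> v < u \<and> u \<le> M}"
      using assms by simp
    then show ?thesis by blast
  qed
  show "bdd_below ((\<lambda>(u, v). (b u - b v) / (u - v)) ` {(u, v). -M' \<le> v \<and> v < u \<and> u \<le> M'})"
    using strict_monoD[OF assms(1)] by (intro bdd_belowI2[of _ 0]) (auto intro!: divide_nonneg_pos less_imp_le)
qed (use assms in auto)

text \<open>
  With slope at least \<open>l\<close> near \<open>r\<close>, the product \<open>(b (r + u) - b r) * u\<close> dominates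
  \<open>l * min \<bar>u\<bar> u\<^sup>2\<close>: it is quadratic for small \<open>u\<close>, but only linear for large \<open>u\<close>, because
  \<open>b\<close> may saturate. The parameter \<open>t\<close> trades the two regimes against each other as in the
  inequality of arithmetic and geometric means.
\<close>

lemma abs_le_mono_increment:
  fixes b :: "real \<Rightarrow> real"
  assumes b: "strict_mono b" and r: "\<bar>r\<bar> \<le> R"
    and t: "0 < t" "t \<le> 1" and slope: "secant_slope_inf b (R + 1) > 0"
  shows "\<bar>u\<bar> \<le> t + (b (r + u) - b r) * u / (secant_slope_inf b (R + 1) * t)"
proof -
  define l where "l = secant_slope_inf b (R + 1)"
  have l: "0 < l" using slope by (simp add: l_def)
  have up: "l * min w 1 \<le> b (r + w) - b r" if "0 \<le> w" for w
  proof -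
    have "l * min w 1 \<le> b (r + min w 1) - b r"
      using secant_slope_inf_le[OF b, of "R + 1" r "r + min w 1"] r that by (auto simp: l_def)
    moreover have "b (r + min w 1) \<le> b (r + w)"
      using strict_mono_mono[OF b] by (rule monoD) auto
    ultimately show ?thesis by simp
  qed
  have down: "l * min w 1 \<le> b r - b (r - w)" if "0 \<le> w" for w
  proof -
    have "l * min w 1 \<le> b r - b (r - min w 1)"
      using secant_slope_inf_le[OF b, of "R + 1" "r - min w 1" r] r that by (auto simp: l_def)
    moreover have "b (r - w) \<le> b (r - min w 1)"
      using strict_mono_mono[OF b] by (rule monoD) auto
    ultimately show ?thesis by simp
  qed
  have main: "l * min \<bar>u\<bar> 1 * \<bar>u\<bar> \<le> (b (r + u) - b r) * u"
  proof (cases "0 \<le> u")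
    case True
    then show ?thesis using mult_right_mono[OF up[OF True] True] by simp
  next
    case False
    then have "0 \<le> - u" by simp
    from mult_right_mono[OF down[OF this] this] show ?thesis
      using False by (simp add: algebra_simps)
  qed
  have "\<bar>u\<bar> * t \<le> t\<^sup>2 + min \<bar>u\<bar> 1 * \<bar>u\<bar>"
  proof (cases "\<bar>u\<bar> \<le> 1")
    case True
    have "0 \<le> (\<bar>u\<bar> - t)\<^sup>2" "0 \<le> \<bar>u\<bar> * t" using t by auto
    then show ?thesis using True by (simp add: power2_eq_square algebra_simps)
  next
    case False
    have "\<bar>u\<bar> * t \<le> \<bar>u\<bar>" using t by (intro mult_left_le) auto
    then show ?thesis using False by (simp add: add_increasing)
  qed
  then have "l * (\<bar>u\<bar> * t) \<le> l * (t\<^sup>2 + min \<bar>u\<bar> 1 * \<bar>u\<bar>)"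
    using l by simp
  then have "\<bar>u\<bar> * (l * t) \<le> t * (l * t) + (b (r + u) - b r) * u"
    using main by (simp add: algebra_simps power2_eq_square)
  then have "\<bar>u\<bar> \<le> (t * (l * t) + (b (r + u) - b r) * u) / (l * t)"
    using l t by (subst pos_le_divide_eq) auto
  also have "\<dots> = t + (b (r + u) - b r) * u / (l * t)"
    using l t by (simp add: add_divide_distrib)
  finally show ?thesis by (simp add: l_def)
qed

section \<open>One step of the Elo process\<close>

definition sq_error :: "nat \<Rightarrow> (nat \<Rightarrow> real) \<Rightarrow> (nat \<Rightarrow> real) \<Rightarrow> real" where
  "sq_error N \<rho> x = (\<Sum>k\<in>{1..N}. (x k - \<rho> k)\<^sup>2)"

text \<open>
  Up to the factor \<open>2 * K\<close>, the expected decrease of the squared error produced by a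
  game between \<open>i\<close> and \<open>j\<close>, apart from the noise.
\<close>

definition pair_dissipation ::
  "(real \<Rightarrow> real) \<Rightarrow> (nat \<Rightarrow> real) \<Rightarrow> (nat \<Rightarrow> real) \<Rightarrow> nat \<times> nat \<Rightarrow> real" where
  "pair_dissipation b \<rho> x = (\<lambda>(i, j).
     (b (x i - x j) - b (\<rho> i - \<rho> j)) * ((x i - x j) - (\<rho> i - \<rho> j)))"

definition pair_mean :: "nat \<Rightarrow> (nat \<times> nat \<Rightarrow> real) \<Rightarrow> real" where
  "pair_mean N h = (\<Sum>p\<in>players_pairs N. h p) / real (card (players_pairs N))"

lemma pair_dissipation_nonneg:
  assumes "strict_mono b"
  shows "0 \<le> pair_dissipation b \<rho> x p"
  using strict_mono_less_eq[OF assms]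
  by (cases p) (auto simp: pair_dissipation_def zero_le_mult_iff)

lemma finite_players_pairs: "finite (players_pairs N)"
  by (rule finite_subset[of _ "{1..N} \<times> {1..N}"]) (auto simp: players_pairs_def)

lemma card_players_pairs_pos:
  assumes "N \<ge> 2"
  shows "0 < card (players_pairs N)"
proof -
  have "(1, 2) \<in> players_pairs N"
    using assms by (auto simp: players_pairs_def)
  then show ?thesis
    using finite_players_pairs by (auto simp: card_gt_0_iff)
qed

lemma card_players_pairs_le: "card (players_pairs N) \<le> N * N"
proof -
  have "card (players_pairs N) \<le> card ({1..N} \<times> {1..N})"
    by (rule card_mono) (auto simp: players_pairs_def)
  then show ?thesis by (simp add: card_cartesian_product)
qed

lemma sq_error_elo_update:
  assumes ij: "(i, j) \<in> players_pairs N"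
  shows "sq_error N \<rho> (elo_update N b K x i j s) = sq_error N \<rho> x
    + 2 * K * (s - b (x i - x j)) * ((x i - x j) - (\<rho> i - \<rho> j)) + 2 * (K * (s - b (x i - x j)))\<^sup>2"
proof -
  define c where "c = K * (s - b (x i - x j))"
  have i: "i \<in> {1..N}" and j: "j \<in> {1..N}" and ne: "i \<noteq> j"
    using ij by (auto simp: players_pairs_def)
  have "sq_error N \<rho> (elo_update N b K x i j s) =
      (\<Sum>k\<in>{1..N}. (x k - \<rho> k)\<^sup>2 + (if k = i then 2 * c * (x k - \<rho> k) + c\<^sup>2 else 0)
        + (if k = j then c\<^sup>2 - 2 * c * (x k - \<rho> k) else 0))"
    unfolding sq_error_def elo_update_def c_def[symmetric]
    using ne by (intro sum.cong) (auto simp: power2_eq_square algebra_simps)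
  also have "\<dots> = sq_error N \<rho> x + (2 * c * (x i - \<rho> i) + c\<^sup>2) + (c\<^sup>2 - 2 * c * (x j - \<rho> j))"
    using i j by (simp add: sum.distrib sq_error_def)
  also have "\<dots> = sq_error N \<rho> x + 2 * c * ((x i - x j) - (\<rho> i - \<rho> j)) + 2 * c\<^sup>2"
    by (simp add: algebra_simps)
  finally show ?thesis by (simp add: c_def mult.assoc)
qed

text \<open>
  A score has mean \<open>b (\<rho> i - \<rho> j)\<close>, so the linear part of the change of the squared error
  averages to minus the dissipation; scores and their predictions lie in \<open>{-1..1}\<close>, so
  the quadratic part is at most \<open>2 * (2 * K)\<^sup>2\<close>. The dissipation stands on the left
  because subtraction truncates at \<open>0\<close> in \<open>ennreal\<close>.
\<close>

lemma nn_integral_sq_error_game: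
  assumes b_range: "\<And>u. b u \<in> {-1<..<1}" and b_mono: "strict_mono b" and K: "0 < K"
    and \<nu>: "score_laws N b \<rho> \<nu>" and ij: "(i, j) \<in> players_pairs N"
  shows "(\<integral>\<^sup>+s. ennreal (sq_error N \<rho> (elo_update N b K x i j s)) \<partial>\<nu> i j)
      + ennreal (2 * K * pair_dissipation b \<rho> x (i, j))
    \<le> ennreal (sq_error N \<rho> x + 8 * K\<^sup>2)"
proof -
  interpret real_distribution "\<nu> i j"
    using \<nu> ij by (auto simp: score_laws_def)
  have AE: "AE s in \<nu> i j. s \<in> {-1..1}" and mean: "(\<integral>s. s \<partial>\<nu> i j) = b (\<rho> i - \<rho> j)"
    using \<nu> ij by (auto simp: score_laws_def)
  have int [simp]: "integrable (\<nu> i j) (\<lambda>s. s)"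
    proof (rule integrable_const_bound[where B = 1])
    show "AE s in \<nu> i j. norm s \<le> 1"
      using AE by (rule eventually_mono) auto
  qed simp
  let ?h = "\<lambda>s. sq_error N \<rho> x
    + 2 * K * (s - b (x i - x j)) * ((x i - x j) - (\<rho> i - \<rho> j)) + 8 * K\<^sup>2"
  have le: "sq_error N \<rho> (elo_update N b K x i j s) \<le> ?h s" if "s \<in> {-1..1}" for s
  proof -
    have "\<bar>s - b (x i - x j)\<bar> \<le> 2"
      using that b_range[of "x i - x j"] by auto
    then have "(s - b (x i - x j))\<^sup>2 \<le> 2\<^sup>2"
      by (rule power2_le_iff_abs_le[THEN iffD2, rotated]) simp
    then have "K\<^sup>2 * (s - b (x i - x j))\<^sup>2 \<le> K\<^sup>2 * 4"
      by (intro mult_left_mono) auto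
    then show ?thesis
      by (simp add: sq_error_elo_update[OF ij] power_mult_distrib)
  qed
  have nonneg: "0 \<le> sq_error N \<rho> y" for y
    by (simp add: sq_error_def sum_nonneg)
  have h: "AE s in \<nu> i j. 0 \<le> ?h s"
    using AE by (rule eventually_mono) (rule order_trans[OF nonneg le])
  have "(\<integral>\<^sup>+s. ennreal (sq_error N \<rho> (elo_update N b K x i j s)) \<partial>\<nu> i j)
      \<le> (\<integral>\<^sup>+s. ennreal (?h s) \<partial>\<nu> i j)"
    by (rule nn_integral_mono_AE, rule eventually_mono[OF AE]) (rule ennreal_leI[OF le])
  also have "\<dots> = ennreal (\<integral>s. ?h s \<partial>\<nu> i j)"
    using h by (intro nn_integral_eq_integral) auto
  finally have "(\<integral>\<^sup>+s. ennreal (sq_error N \<rho> (elo_update N b K x i j s)) \<partial>\<nu> i j)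
        + ennreal (2 * K * pair_dissipation b \<rho> x (i, j))
      \<le> ennreal (\<integral>s. ?h s \<partial>\<nu> i j) + ennreal (2 * K * pair_dissipation b \<rho> x (i, j))"
    by (rule add_right_mono)
  also have "\<dots> = ennreal ((\<integral>s. ?h s \<partial>\<nu> i j) + 2 * K * pair_dissipation b \<rho> x (i, j))"
    using integral_nonneg_AE[OF h] K pair_dissipation_nonneg[OF b_mono] by simp
  also have "(\<integral>s. ?h s \<partial>\<nu> i j) + 2 * K * pair_dissipation b \<rho> x (i, j)
      = sq_error N \<rho> x + 8 * K\<^sup>2"
    by (simp add: mean prob_space[simplified] pair_dissipation_def algebra_simps)
  finally show ?thesis .
qed

lemma measurable_elo_space_component:
  "k \<in> {1..N} \<Longrightarrow> (\<lambda>x. x k) \<in> borel_measurable (elo_space N)"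
  unfolding elo_space_def by (intro measurable_restrict_space1 measurable_component_singleton)

lemma sq_error_measurable: "sq_error N \<rho> \<in> borel_measurable (elo_space N)"
  unfolding sq_error_def[abs_def]
  by (intro borel_measurable_sum borel_measurable_power borel_measurable_diff
      measurable_elo_space_component borel_measurable_const)

lemma pair_mean_dissipation_measurable:
  assumes "b \<in> borel_measurable borel"
  shows "(\<lambda>x. pair_mean N (pair_dissipation b \<rho> x)) \<in> borel_measurable (elo_space N)"
  unfolding pair_mean_def pair_dissipation_def case_prod_beta
  by (intro borel_measurable_divide borel_measurable_sum borel_measurable_times
      borel_measurable_diff borel_measurable_const measurable_elo_space_component
      measurable_compose[OF _ assms]) (auto simp: players_pairs_def)

lemma nn_integral_elo_kernel:
  assumes N: "N \<ge> 2" and b: "b \<in> borel_measurable borel" and \<nu>: "score_laws N b \<rho> \<nu>"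
    and x: "x \<in> zero_sum N" and g: "g \<in> borel_measurable (elo_space N)"
  shows "(\<integral>\<^sup>+y. g y \<partial>elo_kernel N b \<nu> K x) =
    (\<Sum>(i, j)\<in>players_pairs N. (\<integral>\<^sup>+s. g (elo_update N b K x i j s) \<partial>\<nu> i j)
      * ennreal (1 / real (card (players_pairs N))))"
proof -
  let ?P = "players_pairs N"
  let ?D = "\<lambda>(i, j). distr (\<nu> i j) (elo_space N) (elo_update N b K x i j)"
  have update: "elo_update N b K x i j \<in> \<nu> i j \<rightarrow>\<^sub>M elo_space N"
    and prob: "prob_space (\<nu> i j)" if ij: "(i, j) \<in> ?P" for i j
  proof -
    interpret real_distribution "\<nu> i j"
      using \<nu> ij by (auto simp: score_laws_def)
    have "(\<lambda>s. (x, s)) \<in> \<nu> i j \<rightarrow>\<^sub>M elo_space N \<Otimes>\<^sub>M borel"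
      using x by (intro measurable_Pair measurable_const) (auto simp: space_elo_space)
    from measurable_compose[OF this elo_update_measurable[OF b ij]]
    show "elo_update N b K x i j \<in> \<nu> i j \<rightarrow>\<^sub>M elo_space N" by simp
    show "prob_space (\<nu> i j)" by (rule prob_space_axioms)
  qed
  have D: "?D \<in> uniform_count_measure ?P \<rightarrow>\<^sub>M subprob_algebra (elo_space N)"
    by (subst measurable_cong_sets[OF sets_uniform_count_measure_count_space refl])
      (auto simp: space_subprob_algebra intro!: prob_space_imp_subprob_space
        prob_space.prob_space_distr prob update)
  have "(\<integral>\<^sup>+y. g y \<partial>elo_kernel N b \<nu> K x) = (\<integral>\<^sup>+p. \<integral>\<^sup>+y. g y \<partial>?D p \<partial>uniform_count_measure ?P)"
    unfolding elo_kernel_def by (rule nn_integral_bind[OF g D])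
  also have "\<dots> = (\<Sum>p\<in>?P. (\<integral>\<^sup>+y. g y \<partial>?D p) * ennreal (1 / real (card ?P)))"
    unfolding uniform_count_measure_def
    using finite_players_pairs by (subst nn_integral_point_measure_finite) (auto simp: mult.commute)
  also have "\<dots> = (\<Sum>(i, j)\<in>?P. (\<integral>\<^sup>+s. g (elo_update N b K x i j s) \<partial>\<nu> i j)
      * ennreal (1 / real (card ?P)))"
    by (intro sum.cong refl) (auto simp: nn_integral_distr[OF update] g)
  finally show ?thesis .
qed

lemma elo_drift:
  assumes b_range: "\<And>u. b u \<in> {-1<..<1}" and b_mono: "strict_mono b"
    and b: "b \<in> borel_measurable borel" and K: "0 < K" and N: "N \<ge> 2"
    and \<nu>: "score_laws N b \<rho> \<nu>" and x: "x \<in> zero_sum N"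
  shows "(\<integral>\<^sup>+y. ennreal (sq_error N \<rho> y) \<partial>elo_kernel N b \<nu> K x)
      + ennreal (2 * K * pair_mean N (pair_dissipation b \<rho> x))
    \<le> ennreal (sq_error N \<rho> x) + ennreal (8 * K\<^sup>2)"
proof -
  let ?P = "players_pairs N"
  define a where "a = 1 / real (card ?P)"
  define d where "d = pair_dissipation b \<rho> x"
  have card: "0 < card ?P" by (rule card_players_pairs_pos[OF N])
  have a: "0 \<le> a" by (simp add: a_def)
  have d: "0 \<le> d p" for p
    unfolding d_def by (rule pair_dissipation_nonneg[OF b_mono])
  have V: "0 \<le> sq_error N \<rho> x" by (simp add: sq_error_def sum_nonneg)
  have game: "(\<integral>\<^sup>+s. ennreal (sq_error N \<rho> (elo_update N b K x i j s)) \<partial>\<nu> i j) * ennreal a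
      + ennreal (2 * K * d (i, j) * a) \<le> ennreal ((sq_error N \<rho> x + 8 * K\<^sup>2) * a)"
    if ij: "(i, j) \<in> ?P" for i j
  proof -
    have le: "(\<integral>\<^sup>+s. ennreal (sq_error N \<rho> (elo_update N b K x i j s)) \<partial>\<nu> i j)
        + ennreal (2 * K * d (i, j)) \<le> ennreal (sq_error N \<rho> x + 8 * K\<^sup>2)"
      unfolding d_def by (rule nn_integral_sq_error_game[OF b_range b_mono K \<nu> ij])
    show ?thesis
      using mult_right_mono[OF le, of "ennreal a"] a V d K
      by (simp add: distrib_right ennreal_mult''[symmetric])
  qed
  have "(\<integral>\<^sup>+y. ennreal (sq_error N \<rho> y) \<partial>elo_kernel N b \<nu> K x) + ennreal (2 * K * pair_mean N d)
      = (\<Sum>(i, j)\<in>?P. (\<integral>\<^sup>+s. ennreal (sq_error N \<rho> (elo_update N b K x i j s)) \<partial>\<nu> i j) * ennreal a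
          + ennreal (2 * K * d (i, j) * a))"
  proof -
    have "2 * K * pair_mean N d = (\<Sum>p\<in>?P. 2 * K * d p * a)"
      by (simp add: pair_mean_def a_def sum_divide_distrib sum_distrib_left)
    then have "ennreal (2 * K * pair_mean N d) = (\<Sum>p\<in>?P. ennreal (2 * K * d p * a))"
      using a d K by (simp add: sum_ennreal)
    then show ?thesis
      using nn_integral_elo_kernel[OF N b \<nu> x, of "\<lambda>y. ennreal (sq_error N \<rho> y)" K] sq_error_measurable
      by (simp add: a_def sum.distrib case_prod_beta)
  qed
  also have "\<dots> \<le> (\<Sum>(i, j)\<in>?P. ennreal ((sq_error N \<rho> x + 8 * K\<^sup>2) * a))"
    using game by (intro sum_mono) auto
  also have "\<dots> = ennreal (sq_error N \<rho> x + 8 * K\<^sup>2)"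
  proof -
    have "(\<Sum>(i, j)\<in>?P. ennreal ((sq_error N \<rho> x + 8 * K\<^sup>2) * a))
        = ennreal (\<Sum>p\<in>?P. (sq_error N \<rho> x + 8 * K\<^sup>2) * a)"
      unfolding case_prod_beta using V a by (intro sum_ennreal) simp
    then show ?thesis using card by (simp add: a_def)
  qed
  finally show ?thesis
    using V by (simp add: d_def)
qed

section \<open>From pairs to single players\<close>

text \<open>
  Summing \<open>d i - d j\<close> over \<open>j\<close> gives \<open>N * d i\<close> because the \<open>d j\<close> cancel; so an
  average over pairs controls the average over players with constant \<open>1\<close>,
  whatever \<open>N\<close> is.
\<close>

lemma mean_abs_le_pair_mean:
  fixes d :: "nat \<Rightarrow> real"
  assumes N: "N \<ge> 2" and d: "(\<Sum>i\<in>{1..N}. d i) = 0"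
  shows "1 / real N * (\<Sum>i\<in>{1..N}. \<bar>d i\<bar>) \<le> pair_mean N (\<lambda>(i, j). \<bar>d i - d j\<bar>)"
proof -
  let ?P = "players_pairs N"
  let ?s = "\<Sum>(i, j)\<in>?P. \<bar>d i - d j\<bar>"
  have "real N * \<bar>d i\<bar> \<le> (\<Sum>j\<in>{1..N}. \<bar>d i - d j\<bar>)" for i
  proof -
    have "real N * d i = (\<Sum>j\<in>{1..N}. d i - d j)"
      using d by (simp add: sum_subtractf)
    then have "real N * \<bar>d i\<bar> = \<bar>\<Sum>j\<in>{1..N}. d i - d j\<bar>"
      by (metis abs_mult abs_of_nat)
    then show ?thesis by (simp add: sum_abs)
  qed
  then have "(\<Sum>i\<in>{1..N}. real N * \<bar>d i\<bar>) \<le> (\<Sum>i\<in>{1..N}. \<Sum>j\<in>{1..N}. \<bar>d i - d j\<bar>)"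
    by (intro sum_mono)
  also have "\<dots> = (\<Sum>(i, j)\<in>{1..N} \<times> {1..N}. \<bar>d i - d j\<bar>)"
    by (simp add: sum.cartesian_product)
  also have "\<dots> = ?s"
    by (rule sum.mono_neutral_right) (auto simp: players_pairs_def)
  finally have s: "real N * (\<Sum>i\<in>{1..N}. \<bar>d i\<bar>) \<le> ?s"
    by (simp add: sum_distrib_left)
  have s0: "0 \<le> ?s" by (intro sum_nonneg) auto
  have "1 / real N * (\<Sum>i\<in>{1..N}. \<bar>d i\<bar>) = real N * (\<Sum>i\<in>{1..N}. \<bar>d i\<bar>) / (real N * real N)"
    using N by (simp add: field_simps)
  also have "\<dots> \<le> ?s / (real N * real N)"
    using s by (intro divide_right_mono) auto
  also have "\<dots> \<le> ?s / real (card ?P)"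
    using s0 N card_players_pairs_pos[OF N] card_players_pairs_le[of N]
    by (intro divide_left_mono) (auto simp flip: of_nat_mult)
  finally show ?thesis by (simp add: pair_mean_def)
qed

lemma mean_abs_error_le_dissipation:
  assumes b: "strict_mono b" and slope: "secant_slope_inf b (2 * m + 1) > 0"
    and t: "0 < t" "t \<le> 1" and N: "N \<ge> 2"
    and \<rho>: "\<rho> \<in> zero_sum N" "\<And>i. i \<in> {1..N} \<Longrightarrow> \<bar>\<rho> i\<bar> \<le> m" and x: "x \<in> zero_sum N"
  shows "1 / real N * (\<Sum>i\<in>{1..N}. \<bar>x i - \<rho> i\<bar>)
    \<le> t + pair_mean N (pair_dissipation b \<rho> x) / (secant_slope_inf b (2 * m + 1) * t)"
proof -
  let ?P = "players_pairs N" and ?l = "secant_slope_inf b (2 * m + 1)"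
  have card: "0 < card ?P" by (rule card_players_pairs_pos[OF N])
  have pair: "\<bar>(x i - \<rho> i) - (x j - \<rho> j)\<bar> \<le> t + pair_dissipation b \<rho> x (i, j) / (?l * t)"
    if "(i, j) \<in> ?P" for i j
  proof -
    have "\<bar>\<rho> i - \<rho> j\<bar> \<le> 2 * m"
      using \<rho>(2)[of i] \<rho>(2)[of j] that by (auto simp: players_pairs_def)
    from abs_le_mono_increment[OF b this t slope, of "(x i - x j) - (\<rho> i - \<rho> j)"]
    show ?thesis by (simp add: pair_dissipation_def algebra_simps)
  qed
  have "1 / real N * (\<Sum>i\<in>{1..N}. \<bar>x i - \<rho> i\<bar>)
      \<le> pair_mean N (\<lambda>(i, j). \<bar>(x i - \<rho> i) - (x j - \<rho> j)\<bar>)"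
    using \<rho>(1) x by (intro mean_abs_le_pair_mean[OF N]) (simp add: zero_sum_def sum_subtractf)
  also have "\<dots> \<le> pair_mean N (\<lambda>p. t + pair_dissipation b \<rho> x p / (?l * t))"
    unfolding pair_mean_def using pair by (intro divide_right_mono sum_mono) auto
  also have "\<dots> = t + pair_mean N (pair_dissipation b \<rho> x) / (?l * t)"
    using card by (simp add: pair_mean_def sum.distrib add_divide_distrib
      flip: sum_divide_distrib)
  finally show ?thesis .
qed

section \<open>Accuracy of Elo ratings at stationarity\<close>

lemma stationary_dissipation_bound:
  assumes b_range: "\<And>u. b u \<in> {-1<..<1}" and b_mono: "strict_mono b"
    and b: "b \<in> borel_measurable borel" and K: "0 < K" and N: "N \<ge> 2"
    and \<nu>: "score_laws N b \<rho> \<nu>"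
    and stat: "stationary_distribution (elo_space N) (elo_kernel N b \<nu> K) \<pi>"
  shows "integrable \<pi> (\<lambda>x. pair_mean N (pair_dissipation b \<rho> x))"
    and "(\<integral>x. pair_mean N (pair_dissipation b \<rho> x) \<partial>\<pi>) \<le> 4 * K"
proof -
  let ?d = "\<lambda>x. pair_mean N (pair_dissipation b \<rho> x)"
  have sets_\<pi> [measurable_cong]: "sets \<pi> = sets (elo_space N)"
    using stat by (simp add: stationary_distribution_def)
  have d [measurable]: "?d \<in> borel_measurable (elo_space N)"
    by (rule pair_mean_dissipation_measurable[OF b])
  have V [measurable]: "sq_error N \<rho> \<in> borel_measurable (elo_space N)"
    by (rule sq_error_measurable)
  have d0: "0 \<le> ?d x" for x
    by (simp add: pair_mean_def sum_nonneg pair_dissipation_nonneg[OF b_mono])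
  have bound: "(\<integral>\<^sup>+x. ennreal (2 * K * ?d x) \<partial>\<pi>) \<le> ennreal (8 * K\<^sup>2)"
    by (rule stationary_drift_bound[OF elo_kernel_measurable[OF N b \<nu>] stat,
          where V = "\<lambda>x. ennreal (sq_error N \<rho> x)"])
      (auto simp: space_elo_space intro!: elo_drift[OF b_range b_mono b K N \<nu>])
  have int: "integrable \<pi> (\<lambda>x. 2 * K * ?d x)"
  proof (rule integrableI_nonneg)
    show "(\<integral>\<^sup>+x. ennreal (2 * K * ?d x) \<partial>\<pi>) < \<infinity>"
      using bound by (auto intro: le_less_trans)
  qed (use K d0 in auto)
  then show "integrable \<pi> ?d" using K by simp
  have "ennreal (\<integral>x. 2 * K * ?d x \<partial>\<pi>) \<le> ennreal (8 * K\<^sup>2)"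
    using bound nn_integral_eq_integral[OF int] K d0 by simp
  then have "2 * K * (\<integral>x. ?d x \<partial>\<pi>) \<le> 2 * K * (4 * K)"
    by (simp add: power2_eq_square)
  then show "(\<integral>x. ?d x \<partial>\<pi>) \<le> 4 * K" using K by simp
qed

theorem theorem2:
  fixes b :: "real \<Rightarrow> real" and L :: real
  assumes b_range: "\<And>u. b u \<in> {-1<..<1}"
    and b_odd: "\<And>u. b (- u) = - b u"
    and b_mono: "strict_mono b"
    and b_lipschitz: "L-lipschitz_on UNIV b"
    and b_slope: "\<And>M. M > 0 \<Longrightarrow> secant_slope_inf b M > 0"
  shows "\<exists>C :: real \<Rightarrow> real. mono_on {0..} C \<and>
    (\<forall>m\<ge>0. C m > 0 \<and>
      (\<exists>K\<^sub>0>0. \<forall>K. 0 < K \<and> K < K\<^sub>0 \<and> K * L < 1 \<longrightarrow>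
        (\<forall>N\<ge>2. \<forall>\<rho> \<in> zero_sum N. \<forall>\<nu> \<pi>.
           Max ((\<lambda>i. \<bar>\<rho> i\<bar>) ` {1..N}) = m \<and> score_laws N b \<rho> \<nu> \<and>
           stationary_distribution (elo_space N) (elo_kernel N b \<nu> K) \<pi> \<longrightarrow>
             integrable \<pi> (\<lambda>x. 1 / real N * (\<Sum>i\<in>{1..N}. \<bar>x i - \<rho> i\<bar>)) \<and>
             (\<integral>x. 1 / real N * (\<Sum>i\<in>{1..N}. \<bar>x i - \<rho> i\<bar>) \<partial>\<pi>) \<le> C m * sqrt K)))"
proof -
  define l where "l m = secant_slope_inf b (2 * m + 1)" for m
  define C where "C m = 1 + 4 / l m" for m
  have l: "0 < l m" if "0 \<le> m" for m
    unfolding l_def by (rule b_slope) (use that in simp)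
  have b [measurable]: "b \<in> borel_measurable borel"
    using lipschitz_on_continuous_on[OF b_lipschitz] by (rule borel_measurable_continuous_onI)
  have "mono_on {0..} C"
  proof (rule mono_onI)
    fix m m' :: real assume m: "m \<in> {0..}" "m' \<in> {0..}" "m \<le> m'"
    then have "l m' \<le> l m"
      unfolding l_def by (intro secant_slope_inf_antimono[OF b_mono]) auto
    then show "C m \<le> C m'"
      using l[of m] l[of m'] m by (simp add: C_def divide_left_mono)
  qed
  moreover have "C m > 0" if "m \<ge> 0" for m
    using l[OF that] by (simp add: C_def add_pos_pos)
  moreover have "integrable \<pi> (\<lambda>x. 1 / real N * (\<Sum>i\<in>{1..N}. \<bar>x i - \<rho> i\<bar>)) \<and>
      (\<integral>x. 1 / real N * (\<Sum>i\<in>{1..N}. \<bar>x i - \<rho> i\<bar>) \<partial>\<pi>) \<le> C m * sqrt K"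
    if m: "m \<ge> 0" and K: "0 < K" "K < 1" and N: "N \<ge> 2" and \<rho>: "\<rho> \<in> zero_sum N"
      and max: "Max ((\<lambda>i. \<bar>\<rho> i\<bar>) ` {1..N}) = m" and \<nu>: "score_laws N b \<rho> \<nu>"
      and stat: "stationary_distribution (elo_space N) (elo_kernel N b \<nu> K) \<pi>"
    for m K N \<rho> \<nu> \<pi>
  proof -
    interpret prob_space \<pi>
      using stat by (simp add: stationary_distribution_def)
    have sets_\<pi>: "sets \<pi> = sets (elo_space N)"
      using stat by (simp add: stationary_distribution_def)
    have space_\<pi>: "space \<pi> = zero_sum N"
      using sets_eq_imp_space_eq[OF sets_\<pi>] by (simp add: space_elo_space)
    let ?f = "\<lambda>x. 1 / real N * (\<Sum>i\<in>{1..N}. \<bar>x i - \<rho> i\<bar>)"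
    let ?d = "\<lambda>x. pair_mean N (pair_dissipation b \<rho> x)"
    let ?g = "\<lambda>x. sqrt K + ?d x / (l m * sqrt K)"
    note dissipation = stationary_dissipation_bound[OF b_range b_mono b K(1) N \<nu> stat]
    \<comment> \<open>The choice \<open>t = sqrt K\<close> balances \<open>t\<close> against the mean dissipation, of order \<open>K / t\<close>.\<close>
    have le: "?f x \<le> ?g x" if "x \<in> space \<pi>" for x
    proof -
      have "\<bar>\<rho> i\<bar> \<le> m" if "i \<in> {1..N}" for i
        using that Max_ge[of "(\<lambda>i. \<bar>\<rho> i\<bar>) ` {1..N}" "\<bar>\<rho> i\<bar>"] max by auto
      then show ?thesis
        using mean_abs_error_le_dissipation[OF b_mono _ _ _ N \<rho>, of m "sqrt K" x] that l[OF m] K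
        by (simp add: l_def space_\<pi>)
    qed
    have f0: "0 \<le> ?f x" for x
      by (simp add: sum_nonneg)
    have int_g: "integrable \<pi> ?g"
      using dissipation(1) by simp
    have meas: "?f \<in> borel_measurable \<pi>"
      unfolding measurable_cong_sets[OF sets_\<pi> refl]
      by (intro borel_measurable_times borel_measurable_sum borel_measurable_abs
          borel_measurable_diff borel_measurable_const measurable_elo_space_component)
    have int_f: "integrable \<pi> ?f"
    proof (rule Bochner_Integration.integrable_bound[OF int_g meas], rule AE_I2)
      fix x assume "x \<in> space \<pi>"
      then show "norm (?f x) \<le> norm (?g x)"
        using le[of x] f0[of x] by (simp del: times_divide_eq_left)
    qed
    have "(\<integral>x. ?f x \<partial>\<pi>) \<le> (\<integral>x. ?g x \<partial>\<pi>)"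
      by (rule integral_mono[OF int_f int_g le])
    also have "\<dots> = sqrt K + (\<integral>x. ?d x \<partial>\<pi>) / (l m * sqrt K)"
      using dissipation(1) by (simp add: prob_space)
    also have "\<dots> \<le> sqrt K + 4 * K / (l m * sqrt K)"
      using dissipation(2) l[OF m] K by (intro add_left_mono divide_right_mono) auto
    also have "\<dots> = C m * sqrt K"
    proof -
      have "K / sqrt K = sqrt K"
        using K by (simp add: real_div_sqrt)
      then have "4 * K / (l m * sqrt K) = 4 / l m * sqrt K"
        by (metis times_divide_times_eq)
      then show ?thesis by (simp add: C_def distrib_right)
    qed
    finally show ?thesis using int_f by blast
  qed
  ultimately show ?thesis
    by (intro exI[of _ C]) (auto intro!: exI[of _ "1::real"])
qed

end
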